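(* Let $n=2r+1$ ($r\ge1$) and $1\le\ell\le r+1$. We have the equality of sets $$\mathcal M(e^{\varpi_\ell}Y_{\ell,0}Y_{0,\ell}^{-1})=\bigcup_{k\in\mathbb Z}(\tau_{n+1,-\ell\delta})^k\Big(\bigcup_{j=0}^n\mathcal M_{I_j}(Y_{\ell+j,j}Y_{j,\ell+j}^{-1})\Big).$$
   Context: Root data. $I=\{0,\dots,n\}$ identified with $\mathbb Z/(n+1)\mathbb Z$ (first indices of the variables $Y_{i,l}$ are read modulo $n+1$), $I_j=I\setminus\{j\}$, $C=(C_{i,j})_{i,j\in I}$ the Cartan matrix of type $A_n^{(1)}$ ($C_{i,i}=2$, $C_{i,i\pm1}=-1$, other entries $0$), $\mathfrak h=\bigoplus_{i\in I}\mathbb Q h_i\oplus\mathbb Q d$; $\alpha_i(h_j)=C_{j,i}$, $\alpha_i(d)=\delta_{0,i}$, $\Lambda_i(h_j)=\delta_{i,j}$, $\Lambda_i(d)=0$; $\delta=\sum_i\alpha_i$, $P=\{\lambda\in\mathfrak h^*:\lambda(h_i)\in\mathbb Z\ \forall i\}$, $\varpi_\ell=\Lambda_\ell-\Lambda_0$. Monomial crystal. Consider monomials $m=e^{\omega(m)}\prod_{i\in I,l\in\mathbb Z}Y_{i,l}^{u_{i,l}(m)}$ with $u_{i,l}(m)\in\mathbb Z$ (finitely many non-zero), $\omega(m)\in P$, $\sum_l u_{i,l}(m)=\omega(m)(h_i)$. Put $A_{i,l}=e^{\alpha_i}Y_{i,l-1}Y_{i,l+1}Y_{i-1,l}^{-1}Y_{i+1,l}^{-1}$.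 Fix $s:I\to\{0,1\}$ with $s_i+s_j=1$ whenever $C_{i,j}=-1$ (chosen so that the monomials considered lie in $\mathcal M$); $\mathcal M$ is the group of monomials with $u_{i,l}(m)=0$ whenever $l\equiv s_i+1\bmod 2$. Set $\mathrm{wt}(m)=\omega(m)$, $\varphi_{i,L}(m)=\sum_{l\le L}u_{i,l}(m)$, $\varphi_i(m)=\max_L\varphi_{i,L}(m)$, $\varepsilon_{i,L}(m)=-\sum_{l\ge L}u_{i,l}(m)$, $\varepsilon_i(m)=\max_L\varepsilon_{i,L}(m)$, $p_i(m)=\max\{L:\varepsilon_{i,L}(m)=\varepsilon_i(m)\}$, $q_i(m)=\min\{L:\varphi_{i,L}(m)=\varphi_i(m)\}$; $\tilde e_i\cdot m=0$ if $\varepsilon_i(m)=0$, else $mA_{i,p_i(m)-1}$; $\tilde f_i\cdot m=0$ if $\varphi_i(m)=0$, else $mA_{i,q_i(m)+1}^{-1}$. $\mathcal M(m)$ is the connected subcrystal generated by $m$, and for $J\subset I$, $\mathcal M_J(m)$ is the set of monomials obtained from $m$ by applying the operators $\tilde e_i,\tilde f_i$ with $i\in J$. Within $\mathcal M(e^{\varpi_\ell}Y_{\ell,0}Y_{0,\ell}^{-1})$ the factor $e^{\omega(m')}$ of an element $m'$ is determined by the exponents $u_{i,l}(m')$ and is omitted from notation; the monomials $Y_{\ell+j,j}Y_{j,\ell+j}^{-1}$, $0\le j\le n$, belong to $\mathcal M(e^{\varpi_\ell}Y_{\ell,0}Y_{0,\ell}^{-1})$ in this sense. Shift: $\tau_{n+1,-\ell\delta}(e^\lambda\prod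 Y_{i,l}^{u_{i,l}})=e^{\lambda-\ell\delta}\prod Y_{i,l+n+1}^{u_{i,l}}$. *)

theory Defs
  imports Complex_Main "HOL-Library.Function_Algebras"
begin

section \<open>Root data of type \<open>A\<^sub>n\<^sup>(\<^sup>1\<^sup>)\<close>, for \<open>n \<ge> 2\<close>\<close>

text \<open>
  The index set \<open>I\<close> is \<open>{0..n}\<close>, identified with the integers modulo \<open>n + 1\<close>.  The entries
  below are those of the affine Cartan matrix only for \<open>n \<ge> 2\<close>.
\<close>

definition cartan :: "nat \<Rightarrow> nat \<Rightarrow> nat \<Rightarrow> int" where
  "cartan n i j =
     (if i = j then 2
      else if i = (j + 1) mod (n + 1) \<or> j = (i + 1) mod (n + 1) then - 1
      else 0)"

text \<open>
  An element of the dual of the rational vector space with basis \<open>h\<^sub>0, \<dots>, h\<^sub>n, d\<close> is given by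
  its values on this basis.  Values at \<open>H i\<close> with \<open>i > n\<close> are junk and are \<open>0\<close> by convention.
\<close>

datatype cobasis = H nat | D

type_synonym weight = "cobasis \<Rightarrow> rat"

definition simple_root :: "nat \<Rightarrow> nat \<Rightarrow> weight" where
  "simple_root n i x =
     (case x of H j \<Rightarrow> if j \<le> n then of_int (cartan n j i) else 0
              | D \<Rightarrow> if i = 0 then 1 else 0)"

definition fund_weight :: "nat \<Rightarrow> weight" where
  "fund_weight i x = (case x of H j \<Rightarrow> if j = i then 1 else 0 | D \<Rightarrow> 0)"

definition null_root :: "nat \<Rightarrow> weight" where
  "null_root n = (\<Sum>i\<in>{0..n}. simple_root n i)"

definition varpi :: "nat \<Rightarrow> weight" where
  "varpi l = fund_weight l - fund_weight 0"

definition weight_lattice :: "nat \<Rightarrow> weight set" where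
  "weight_lattice n = {w. (\<forall>i\<le>n. w (H i) \<in> \<int>) \<and> (\<forall>i>n. w (H i) = 0)}"


section \<open>Monomials\<close>

text \<open>
  \<open>Monomial w u\<close> stands for the formal product of \<open>e\<^sup>w\<close> and of all \<open>Y\<^bsub>i,l\<^esub>\<close> to the power \<open>u i l\<close>.
  The type also contains products violating the compatibility and finiteness conditions on
  \<open>w\<close> and \<open>u\<close>; these are imposed in \<open>monomials\<close> below.
\<close>

datatype monomial = Monomial (wt: weight) (expo: "nat \<Rightarrow> int \<Rightarrow> int")

instantiation monomial :: comm_monoid_mult
begin

definition one_monomial :: monomial where
  "1 = Monomial 0 0"

definition times_monomial :: "monomial \<Rightarrow> monomial \<Rightarrow> monomial" where
  "m * m' = Monomial (wt m + wt m') (expo m + expo m')"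

instance
  by standard (auto simp: one_monomial_def times_monomial_def add_ac)

end

instantiation monomial :: inverse
begin

definition inverse_monomial :: "monomial \<Rightarrow> monomial" where
  "inverse m = Monomial (- wt m) (- expo m)"

definition divide_monomial :: "monomial \<Rightarrow> monomial \<Rightarrow> monomial" where
  "(m :: monomial) div m' = m * inverse m'"

instance ..

end

lemma monomial_right_inverse: "m * inverse m = (1 :: monomial)"
  by (simp add: one_monomial_def times_monomial_def inverse_monomial_def)

definition exp_wt :: "weight \<Rightarrow> monomial" where
  "exp_wt w = Monomial w 0"

text \<open>The first index of \<open>Y\<close> is read modulo \<open>n + 1\<close>, the second one is an honest integer.\<close>

definition Y :: "nat \<Rightarrow> int \<Rightarrow> int \<Rightarrow> monomial" where
  "Y n i l =
     Monomial 0 (\<lambda>i' l'. if i' = nat (i mod (int n + 1)) \<and> l' = l then 1 else 0)"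

definition A :: "nat \<Rightarrow> nat \<Rightarrow> int \<Rightarrow> monomial" where
  "A n i l =
     exp_wt (simple_root n i) * Y n (int i) (l - 1) * Y n (int i) (l + 1)
       * inverse (Y n (int i - 1) l) * inverse (Y n (int i + 1) l)"

definition monomials :: "nat \<Rightarrow> monomial set" where
  "monomials n =
     {m. wt m \<in> weight_lattice n
       \<and> (\<forall>i>n. \<forall>l. expo m i l = 0)
       \<and> finite {(i, l). expo m i l \<noteq> 0}
       \<and> (\<forall>i\<le>n. of_int (\<Sum>l | expo m i l \<noteq> 0. expo m i l) = wt m (H i))}"

definition parity_function :: "nat \<Rightarrow> (nat \<Rightarrow> nat) \<Rightarrow> bool" where
  "parity_function n s \<longleftrightarrow>
     (\<forall>i\<le>n. s i \<in> {0, 1}) \<and>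
     (\<forall>i\<le>n. \<forall>j\<le>n. cartan n i j = - 1 \<longrightarrow> s i + s j = 1)"

definition monomial_group :: "nat \<Rightarrow> (nat \<Rightarrow> nat) \<Rightarrow> monomial set" where
  "monomial_group n s =
     {m \<in> monomials n.
        \<forall>i\<le>n. \<forall>l. l mod 2 = (int (s i) + 1) mod 2 \<longrightarrow> expo m i l = 0}"


section \<open>The monomial crystal\<close>

text \<open>
  The sums over \<open>l \<le> L\<close> and \<open>l \<ge> L\<close> are restricted to the (finite) support, because a sum over
  an infinite index set would be \<open>0\<close>.
\<close>

definition phi_at :: "nat \<Rightarrow> int \<Rightarrow> monomial \<Rightarrow> int" where
  "phi_at i L m = (\<Sum>l | l \<le> L \<and> expo m i l \<noteq> 0. expo m i l)"

definition phi :: "nat \<Rightarrow> monomial \<Rightarrow> int" where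
  "phi i m = Max (range (\<lambda>L. phi_at i L m))"

definition epsilon_at :: "nat \<Rightarrow> int \<Rightarrow> monomial \<Rightarrow> int" where
  "epsilon_at i L m = - (\<Sum>l | l \<ge> L \<and> expo m i l \<noteq> 0. expo m i l)"

definition epsilon :: "nat \<Rightarrow> monomial \<Rightarrow> int" where
  "epsilon i m = Max (range (\<lambda>L. epsilon_at i L m))"

text \<open>
  \<open>p_idx i m\<close> is meaningful only if \<open>epsilon i m > 0\<close>, and \<open>q_idx i m\<close> only if \<open>phi i m > 0\<close>;
  otherwise the extremum need not exist, and the operators below do not use it.
\<close>

definition p_idx :: "nat \<Rightarrow> monomial \<Rightarrow> int" where
  "p_idx i m = (GREATEST L. epsilon_at i L m = epsilon i m)"

definition q_idx :: "nat \<Rightarrow> monomial \<Rightarrow> int" where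
  "q_idx i m = (LEAST L. phi_at i L m = phi i m)"

text \<open>\<open>None\<close> represents the value \<open>0\<close> of the Kashiwara operators.\<close>

definition e_op :: "nat \<Rightarrow> nat \<Rightarrow> monomial \<Rightarrow> monomial option" where
  "e_op n i m = (if epsilon i m = 0 then None else Some (m * A n i (p_idx i m - 1)))"

definition f_op :: "nat \<Rightarrow> nat \<Rightarrow> monomial \<Rightarrow> monomial option" where
  "f_op n i m = (if phi i m = 0 then None else Some (m * inverse (A n i (q_idx i m + 1))))"

text \<open>
  \<open>subcrystal n J m\<close> is \<open>\<M>\<^sub>J(m)\<close>.  The operators preserve every \<open>monomial_group n s\<close> with
  \<open>s\<close> a parity function, so the ambient group does not enter its definition.
\<close>

inductive_set subcrystal :: "nat \<Rightarrow> nat set \<Rightarrow> monomial \<Rightarrow> monomial set"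
  for n :: nat and J :: "nat set" and m :: monomial where
  base: "m \<in> subcrystal n J m"
| e_step: "m' \<in> subcrystal n J m \<Longrightarrow> i \<in> J \<Longrightarrow> e_op n i m' = Some m'' \<Longrightarrow> m'' \<in> subcrystal n J m"
| f_step: "m' \<in> subcrystal n J m \<Longrightarrow> i \<in> J \<Longrightarrow> f_op n i m' = Some m'' \<Longrightarrow> m'' \<in> subcrystal n J m"

definition crystal :: "nat \<Rightarrow> monomial \<Rightarrow> monomial set" where
  "crystal n m = subcrystal n {0..n} m"

definition base_monomial :: "nat \<Rightarrow> nat \<Rightarrow> monomial" where
  "base_monomial n \<l> = exp_wt (varpi \<l>) * Y n (int \<l>) 0 * inverse (Y n 0 (int \<l>))"

text \<open>
  Elements of \<open>crystal n (base_monomial n \<l>)\<close> are written by their \<open>Y\<close>-part \<open>y\<close> alone, the weight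
  factor being determined by it: \<open>with_weight n \<l> y\<close> is the element of that crystal
  with the same exponents as \<open>y\<close>.
\<close>

definition with_weight :: "nat \<Rightarrow> nat \<Rightarrow> monomial \<Rightarrow> monomial" where
  "with_weight n \<l> y = (THE m. m \<in> crystal n (base_monomial n \<l>) \<and> expo m = expo y)"

definition corner_monomial :: "nat \<Rightarrow> nat \<Rightarrow> nat \<Rightarrow> monomial" where
  "corner_monomial n \<l> j =
     with_weight n \<l> (Y n (int \<l> + int j) (int j) * inverse (Y n (int j) (int \<l> + int j)))"

text \<open>
  \<open>shift a w\<close> is \<open>\<tau>\<^bsub>a,w\<^esub>\<close>: it replaces each \<open>Y\<^bsub>i,l\<^esub>\<close> by \<open>Y\<^bsub>i,l+a\<^esub>\<close>, so the exponent of
  \<open>Y\<^bsub>i,l\<^esub>\<close> in the image is the exponent of \<open>Y\<^bsub>i,l-a\<^esub>\<close> in the argument.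
\<close>

definition shift :: "int \<Rightarrow> weight \<Rightarrow> monomial \<Rightarrow> monomial" where
  "shift a w m = Monomial (wt m + w) (\<lambda>i l. expo m i (l - a))"

definition tau :: "nat \<Rightarrow> nat \<Rightarrow> monomial \<Rightarrow> monomial" where
  "tau n \<l> = shift (int n + 1) (\<lambda>x. - of_nat \<l> * null_root n x)"

definition int_funpow :: "('a \<Rightarrow> 'a) \<Rightarrow> int \<Rightarrow> 'a \<Rightarrow> 'a" where
  "int_funpow f k = (if k \<ge> 0 then f ^^ nat k else inv f ^^ nat (- k))"

end

theory Submission
  imports Defs
begin

text \<open>
  Write \<open>N = n + 1\<close>.  For integers \<open>i\<close> and \<open>p\<close> consider the box
  \<open>[i]\<^sub>p = Y\<^bsub>i,p+i-1\<^esub> Y\<^bsub>i-1,p+i\<^esub>\<^sup>-\<^sup>1\<close>, with a suitable weight factor.  The monomials \<open>A\<close> move boxes: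
  \<open>[i]\<^sub>p A\<^bsub>i,p+i\<^esub>\<^sup>-\<^sup>1 = [i+1]\<^sub>p\<close> (\<open>box_step\<close>).  A column is a sequence of integers
  \<open>c\<^sub>1 < \<dots> < c\<^sub>\<l> < c\<^sub>1 + N\<close>, and its monomial is the product of the boxes \<open>[c\<^sub>k]\<^sub>p\<close> with
  \<open>p = \<l> + 1 - 2 k\<close>.  The monomial \<open>Y\<^bsub>\<l>+a,a\<^esub> Y\<^bsub>a,\<l>+a\<^esub>\<^sup>-\<^sup>1\<close> is the telescoping product belonging to the
  column \<open>a+1, \<dots>, a+\<l>\<close>, which is called a corner.

  The entries of a column are pairwise distinct modulo \<open>N\<close>, so for each residue \<open>i\<close> at most one
  box contributes a positive power \<open>Y\<^bsub>i,x\<^esub>\<close> (the box with entry congruent to \<open>i\<close>) and at most one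
  contributes a negative power \<open>Y\<^bsub>i,y\<^esub>\<^sup>-\<^sup>1\<close> (entry congruent to \<open>i + 1\<close>).  If only the first occurs,
  \<open>f\<^sub>i\<close> raises that entry by one and \<open>e\<^sub>i\<close> vanishes; if only the second occurs, \<open>e\<^sub>i\<close> lowers that entry
  by one and \<open>f\<^sub>i\<close> vanishes.  If both occur, then \<open>y \<le> x\<close>, and both operators vanish.  This inequality
  (\<open>adjacent_boxes_level\<close>) is the place where \<open>2 \<l> \<le> N\<close> enters: the two boxes are either
  consecutive, and cancel, or they are the last and the first one, and then \<open>x - y = N - 2 \<l>\<close>.

  Hence columns are stable under the operators.  The operators with index different from \<open>a\<close>
  modulo \<open>N\<close> never move an entry out of the window \<open>{a+1, \<dots>, a+N}\<close>, and inside this window every column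
  can be lowered to the corner one entry at a time.  So the subcrystal of the corner for
  \<open>I \<setminus> {a}\<close> consists exactly of the columns in this window (\<open>subcrystal_corner\<close>).  Each column lies in
  some window, and the windows of \<open>a\<close> and \<open>a + 1\<close> share a corner, so the whole crystal
  consists of all columns (\<open>crystal_corner\<close>).  Since \<open>\<tau>\<close> adds \<open>N\<close> to every entry, its powers move the
  windows \<open>a = 0, \<dots>, n\<close> to all windows, which gives the claimed union.

  The weight factor of a column monomial is determined by its exponents (\<open>wt_col_determined\<close>), so
  the corners named by their exponents in the claim are the corner columns.
\<close>

section \<open>Arithmetic of monomials and of residues\<close>

lemma expo_simps:
  "expo (m * m') i l = expo m i l + expo m' i l"
  "expo (inverse m) i l = - expo m i l"
  "expo (exp_wt w) i l = 0"
  "expo 1 i l = 0"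
  by (simp_all add: times_monomial_def inverse_monomial_def exp_wt_def one_monomial_def)

lemma wt_simps:
  "wt (m * m') x = wt m x + wt m' x"
  "wt (inverse m) x = - wt m x"
  "wt (exp_wt w) = w"
  "wt (1::monomial) x = 0"
  "wt (Y n i l) x = 0"
  by (simp_all add: times_monomial_def inverse_monomial_def exp_wt_def one_monomial_def Y_def)

lemma monomial_eqI:
  assumes "\<And>x. wt m x = wt m' x" and "\<And>i l. expo m i l = expo m' i l"
  shows "m = m'"
  using assms by (cases m; cases m') (auto simp: fun_eq_iff)

lemma expo_Y: "expo (Y n i l) j l' = of_bool (int j = i mod (int n + 1) \<and> l' = l)"
proof -
  have "j = nat (i mod (int n + 1)) \<longleftrightarrow> int j = i mod (int n + 1)"
    by (simp add: nat_eq_iff2 eq_commute)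
  thus ?thesis by (auto simp: Y_def)
qed

lemma expo_prod: "expo (\<Prod>k\<in>K. f k) i l = (\<Sum>k\<in>K. expo (f k) i l)"
  by (induction K rule: infinite_finite_induct) (simp_all add: expo_simps)

lemma wt_prod: "wt (\<Prod>k\<in>K. f k :: monomial) x = (\<Sum>k\<in>K. wt (f k) x)"
  by (induction K rule: infinite_finite_induct) (simp_all add: wt_simps)

lemma mod_pred: "(i - 1) mod (int n + 1) = (if i mod (int n + 1) = 0 then int n else i mod (int n + 1) - 1)"
  and mod_succ: "(i + 1) mod (int n + 1) = (if i mod (int n + 1) = int n then 0 else i mod (int n + 1) + 1)"
  and div_pred: "(i - 1) div (int n + 1) = i div (int n + 1) - of_bool (i mod (int n + 1) = 0)"
proof -
  define q a where "q = i div (int n + 1)" and "a = i mod (int n + 1)"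
  have i: "i = a + (int n + 1) * q" by (simp add: q_def a_def)
  have a: "0 \<le> a" "a \<le> int n" using pos_mod_sign[of "int n + 1" i] pos_mod_bound[of "int n + 1" i] by (auto simp: a_def)
  have "(a - 1 + (int n + 1) * q) mod (int n + 1) = (a - 1) mod (int n + 1)" by (rule mod_mult_self2)
  moreover have "(a - 1) mod (int n + 1) = (if a = 0 then int n else a - 1)"
    using a by (auto simp: zmod_minus1)
  ultimately show "(i - 1) mod (int n + 1) = (if i mod (int n + 1) = 0 then int n else i mod (int n + 1) - 1)"
    unfolding a_def[symmetric] using i by (simp add: algebra_simps)
  have "(a + 1 + (int n + 1) * q) mod (int n + 1) = (a + 1) mod (int n + 1)" by (rule mod_mult_self2)
  moreover have "(a + 1) mod (int n + 1) = (if a = int n then 0 else a + 1)"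
    using a by auto
  ultimately show "(i + 1) mod (int n + 1) = (if i mod (int n + 1) = int n then 0 else i mod (int n + 1) + 1)"
    unfolding a_def[symmetric] using i by (simp add: algebra_simps)
  have "(a - 1 + (int n + 1) * q) div (int n + 1) = q + (a - 1) div (int n + 1)"
    by (rule div_mult_self2) simp
  moreover have "(a - 1) div (int n + 1) = - of_bool (a = 0)"
    using a by (auto simp: zdiv_eq_0_iff div_eq_minus1)
  ultimately show "(i - 1) div (int n + 1) = i div (int n + 1) - of_bool (i mod (int n + 1) = 0)"
    unfolding a_def[symmetric] q_def[symmetric] using i by (simp add: algebra_simps)
qed

section \<open>Boxes\<close>

text \<open>
  The entry \<open>i\<close> is an honest integer.  Its class modulo \<open>n + 1\<close> gives the finite part
  \<open>\<Lambda>\<^sub>i - \<Lambda>\<^bsub>i-1\<^esub>\<close>; the value at \<open>D\<close> records how many multiples of \<open>n + 1\<close> have been passed,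
  because passing one of them subtracts the simple root with index \<open>0\<close>.
\<close>

definition box_weight :: "nat \<Rightarrow> int \<Rightarrow> weight" where
  "box_weight n i x =
     (case x of H j \<Rightarrow> of_bool (int j = i mod (int n + 1)) - of_bool (int j = (i - 1) mod (int n + 1))
              | D \<Rightarrow> - of_int ((i - 1) div (int n + 1)))"

definition box :: "nat \<Rightarrow> int \<Rightarrow> int \<Rightarrow> monomial" where
  "box n i p = exp_wt (box_weight n i) * Y n i (p + i - 1) * inverse (Y n (i - 1) (p + i))"

lemma expo_box:
  "expo (box n i p) j l =
     of_bool (int j = i mod (int n + 1) \<and> l = p + i - 1)
       - of_bool (int j = (i - 1) mod (int n + 1) \<and> l = p + i)"
  by (simp add: box_def expo_simps expo_Y)

lemma wt_box: "wt (box n i p) = box_weight n i"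
  by (simp add: fun_eq_iff box_def wt_simps)

text \<open>For \<open>n \<ge> 2\<close> the residues \<open>i - 1\<close>, \<open>i\<close>, \<open>i + 1\<close> are distinct, as the Cartan matrix requires.\<close>

lemma box_weight_step:
  assumes "2 \<le> n"
  shows "box_weight n i x = box_weight n (i + 1) x + simple_root n (nat (i mod (int n + 1))) x"
proof -
  define a where "a = nat (i mod (int n + 1))"
  have a: "i mod (int n + 1) = int a" by (simp add: a_def)
  have an: "a \<le> n" using pos_mod_bound[of "int n + 1" i] a by linarith
  show ?thesis
  proof (cases x)
    case D
    then show ?thesis using a by (simp add: box_weight_def simple_root_def div_pred)
  next
    case (H j)
    have c: "of_int (cartan n j a) =
      (2 * of_bool (j = a) - of_bool (int j = (i - 1) mod (int n + 1)) - of_bool (int j = (i + 1) mod (int n + 1)) :: rat)"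
      if "j \<le> n"
    proof -
      have "(a + 1) mod (n + 1) = (if a = n then 0 else a + 1)"
           "(j + 1) mod (n + 1) = (if j = n then 0 else j + 1)"
        using an that by auto
      then show ?thesis
        unfolding cartan_def mod_pred mod_succ a using an that assms by auto
    qed
    show ?thesis
    proof (cases "j \<le> n")
      case True
      then show ?thesis
        using c by (simp add: H box_weight_def simple_root_def a_def[symmetric] a)
    next
      case False
      then show ?thesis
        unfolding box_weight_def simple_root_def H mod_pred mod_succ
        using a an by (auto simp: mod_pred)
    qed
  qed
qed

lemma box_step:
  assumes "2 \<le> n"
  shows "box n i p = box n (i + 1) p * A n (nat (i mod (int n + 1))) (p + i)"
proof (rule monomial_eqI)
  show "wt (box n i p) x = wt (box n (i + 1) p * A n (nat (i mod (int n + 1))) (p + i)) x" for x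
    using box_weight_step[OF assms, of i x] by (simp add: wt_simps wt_box A_def)
  have shift_index: "p + (i + 1) - 1 = p + i" "i + 1 - 1 = i" "p + (i + 1) = p + i + 1" by simp_all
  show "expo (box n i p) j l = expo (box n (i + 1) p * A n (nat (i mod (int n + 1))) (p + i)) j l" for j l
    unfolding expo_simps expo_box A_def expo_Y shift_index
    by (simp add: mod_diff_left_eq mod_add_left_eq)
qed

text \<open>
  Pairing a signed sum of point masses with a function \<open>Q\<close> depends only on the resulting
  function, not on the way it is written.  It is used to read off weights from exponents.
\<close>

lemma signed_delta_sum_pairing:
  fixes Q :: "'b \<Rightarrow> int"
  assumes "finite K"
    and eq: "\<And>x. (\<Sum>k\<in>K. of_bool (x = a k) - of_bool (x = b k) :: int)
                = (\<Sum>k\<in>K. of_bool (x = a' k) - of_bool (x = b' k))"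
  shows "(\<Sum>k\<in>K. Q (a k) - Q (b k)) = (\<Sum>k\<in>K. Q (a' k) - Q (b' k))"
proof -
  define X where "X = a ` K \<union> b ` K \<union> a' ` K \<union> b' ` K"
  have fX: "finite X" using assms(1) by (simp add: X_def)
  have pair: "(\<Sum>x\<in>X. Q x * (\<Sum>k\<in>K. of_bool (x = f k) - of_bool (x = g k))) = (\<Sum>k\<in>K. Q (f k) - Q (g k))"
    if "f ` K \<subseteq> X" "g ` K \<subseteq> X" for f g
  proof -
    have "(\<Sum>x\<in>X. Q x * (\<Sum>k\<in>K. of_bool (x = f k) - of_bool (x = g k)))
        = (\<Sum>k\<in>K. \<Sum>x\<in>X. Q x * (of_bool (x = f k) - of_bool (x = g k)))"
      unfolding sum_distrib_left by (rule sum.swap)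
    also have "\<dots> = (\<Sum>k\<in>K. Q (f k) - Q (g k))"
    proof (rule sum.cong[OF refl])
      fix k assume "k \<in> K"
      then have "f k \<in> X" "g k \<in> X" using that by auto
      have delta_split: "Q x * (of_bool (x = f k) - of_bool (x = g k))
          = (if x = f k then Q x else 0) - (if x = g k then Q x else 0)" for x
        by simp
      show "(\<Sum>x\<in>X. Q x * (of_bool (x = f k) - of_bool (x = g k))) = Q (f k) - Q (g k)"
        using fX \<open>f k \<in> X\<close> \<open>g k \<in> X\<close> by (simp add: delta_split sum_subtractf)
    qed
    finally show ?thesis .
  qed
  have "(\<Sum>k\<in>K. Q (a k) - Q (b k)) = (\<Sum>x\<in>X. Q x * (\<Sum>k\<in>K. of_bool (x = a k) - of_bool (x = b k)))"
    by (rule pair[symmetric]) (auto simp: X_def)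
  also have "\<dots> = (\<Sum>x\<in>X. Q x * (\<Sum>k\<in>K. of_bool (x = a' k) - of_bool (x = b' k)))"
    by (simp add: eq)
  also have "\<dots> = (\<Sum>k\<in>K. Q (a' k) - Q (b' k))"
    by (rule pair) (auto simp: X_def)
  finally show ?thesis .
qed

section \<open>Strings of the monomials that occur\<close>

text \<open>
  The partial sums defining \<open>phi\<close> and \<open>epsilon\<close> are plus or minus the indicator of a set of
  integers in each of the three shapes of exponents treated below.
\<close>

lemma Max_range_of_bool: "P a \<Longrightarrow> Max (range (\<lambda>L. of_bool (P L) :: int)) = 1"
proof (rule Max_eqI)
  show "finite (range (\<lambda>L. of_bool (P L) :: int))"
    by (rule finite_subset[of _ "{0, 1}"]) auto
qed (auto simp: image_iff)

lemma Max_range_minus_of_bool: "\<not> P b \<Longrightarrow> Max (range (\<lambda>L. - of_bool (P L) :: int)) = 0"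
proof (rule Max_eqI)
  show "finite (range (\<lambda>L. - of_bool (P L) :: int))"
    by (rule finite_subset[of _ "{0, -1}"]) auto
qed (auto simp: image_iff)

lemma string_plus:
  assumes "\<And>l. expo m i l = of_bool (l = c)"
  shows "phi i m = 1" "q_idx i m = c" "epsilon i m = 0"
proof -
  have p: "phi_at i L m = of_bool (c \<le> L)" for L
  proof -
    have "{l. l \<le> L \<and> expo m i l \<noteq> 0} = (if c \<le> L then {c} else {})" by (auto simp: assms)
    then show ?thesis by (simp add: phi_at_def assms)
  qed
  have e: "epsilon_at i L m = - of_bool (L \<le> c)" for L
  proof -
    have "{l. l \<ge> L \<and> expo m i l \<noteq> 0} = (if L \<le> c then {c} else {})" by (auto simp: assms)
    then show ?thesis by (simp add: epsilon_at_def assms)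
  qed
  show phi: "phi i m = 1" unfolding phi_def p by (rule Max_range_of_bool[of _ c]) simp
  show "epsilon i m = 0" unfolding epsilon_def e by (rule Max_range_minus_of_bool[of _ "c + 1"]) simp
  show "q_idx i m = c" unfolding q_idx_def phi
    by (rule Least_equality) (auto simp: p split: if_splits)
qed

lemma string_minus:
  assumes "\<And>l. expo m i l = - of_bool (l = d)"
  shows "phi i m = 0" "epsilon i m = 1" "p_idx i m = d"
proof -
  have p: "phi_at i L m = - of_bool (d \<le> L)" for L
  proof -
    have "{l. l \<le> L \<and> expo m i l \<noteq> 0} = (if d \<le> L then {d} else {})" by (auto simp: assms)
    then show ?thesis by (simp add: phi_at_def assms)
  qed
  have e: "epsilon_at i L m = of_bool (L \<le> d)" for L
  proof -
    have "{l. l \<ge> L \<and> expo m i l \<noteq> 0} = (if L \<le> d then {d} else {})" by (auto simp: assms)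
    then show ?thesis by (simp add: epsilon_at_def assms)
  qed
  show "phi i m = 0" unfolding phi_def p by (rule Max_range_minus_of_bool[of _ "d - 1"]) simp
  show eps: "epsilon i m = 1" unfolding epsilon_def e by (rule Max_range_of_bool[of _ d]) simp
  show "p_idx i m = d" unfolding p_idx_def eps
    by (rule Greatest_equality) (auto simp: e split: if_splits)
qed

text \<open>
  Summing from below, the negative power comes first; summing from above, the positive power comes
  first, but enters \<open>epsilon_at\<close> with a minus sign.  So no partial sum is positive.  The case
  \<open>c = d\<close> covers vanishing exponents.
\<close>

lemma string_minus_plus:
  assumes "\<And>l. expo m i l = of_bool (l = c) - of_bool (l = d)" and "d \<le> c"
  shows "phi i m = 0" "epsilon i m = 0"
proof -
  have p: "phi_at i L m = - of_bool (d \<le> L \<and> L < c)" for L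
  proof -
    have "phi_at i L m = (\<Sum>l\<in>{c, d} \<inter> {..L}. expo m i l)"
      unfolding phi_at_def by (rule sum.mono_neutral_left) (auto simp: assms split: if_splits)
    also have "{c, d} \<inter> {..L} = (if c \<le> L then {c, d} else if d \<le> L then {d} else {})"
      using assms(2) by auto
    finally show ?thesis using assms(2) by (cases "c = d") (auto simp: assms(1))
  qed
  have e: "epsilon_at i L m = - of_bool (d < L \<and> L \<le> c)" for L
  proof -
    have "epsilon_at i L m = - (\<Sum>l\<in>{c, d} \<inter> {L..}. expo m i l)"
      unfolding epsilon_at_def
      by (intro arg_cong[of _ _ uminus] sum.mono_neutral_left) (auto simp: assms split: if_splits)
    also have "{c, d} \<inter> {L..} = (if L \<le> d then {c, d} else if L \<le> c then {c} else {})"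
      using assms(2) by auto
    finally show ?thesis using assms(2) by (cases "c = d") (auto simp: assms(1))
  qed
  show "phi i m = 0" unfolding phi_def p by (rule Max_range_minus_of_bool[of _ c]) simp
  show "epsilon i m = 0" unfolding epsilon_def e by (rule Max_range_minus_of_bool[of _ d]) simp
qed

section \<open>Columns\<close>

lemma sum_of_bool_unique:
  assumes "finite K" "k0 \<in> K" "\<And>k. k \<in> K \<Longrightarrow> P k \<longleftrightarrow> k = k0"
  shows "(\<Sum>k\<in>K. of_bool (P k \<and> R k) :: int) = of_bool (R k0)"
proof -
  have "(\<Sum>k\<in>K. of_bool (P k \<and> R k) :: int) = (\<Sum>k\<in>K. if k = k0 then of_bool (R k0) else 0)"
    by (rule sum.cong) (auto simp: assms(3))
  then show ?thesis using assms(1,2) by simp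
qed

text \<open>
  Going once around the circle subtracts every simple root once, so the null root is the
  difference of the box weights of \<open>0\<close> and \<open>n + 1\<close>.
\<close>

lemma null_root_apply:
  assumes "2 \<le> n"
  shows "null_root n x = (case x of H j \<Rightarrow> 0 | D \<Rightarrow> 1)"
proof -
  have sum_apply: "(\<Sum>i\<in>I. f i) x = (\<Sum>i\<in>I. f i x)" for f :: "nat \<Rightarrow> weight" and I
    by (induction I rule: infinite_finite_induct) simp_all
  have "box_weight n 0 x = box_weight n (int q) x + (\<Sum>i<q. simple_root n i x)" if "q \<le> n + 1" for q
    using that
  proof (induction q)
    case (Suc q)
    then have "nat (int q mod (int n + 1)) = q" by simp
    then show ?case
      using Suc box_weight_step[OF assms, of "int q" x] by (simp add: add.commute)
  qed simp
  from this[of "n + 1"] have "null_root n x = box_weight n 0 x - box_weight n (int n + 1) x"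
    by (simp add: null_root_def sum_apply lessThan_Suc_atMost atMost_atLeast0 add.commute)
  also have "\<dots> = (case x of H j \<Rightarrow> 0 | D \<Rightarrow> 1)"
    by (simp add: box_weight_def zmod_minus1 div_eq_minus1 split: cobasis.split)
  finally show ?thesis .
qed

locale affine_columns =
  fixes n \<l> :: nat
  assumes n: "2 \<le> n" and l: "1 \<le> \<l>" "2 * \<l> \<le> n + 1"
begin

abbreviation N :: int where "N \<equiv> int n + 1"

definition column :: "(nat \<Rightarrow> int) \<Rightarrow> bool" where
  "column c \<longleftrightarrow> (\<forall>j\<in>{1..\<l>}. \<forall>k\<in>{1..\<l>}. j < k \<longrightarrow> c j < c k \<and> c k < c j + N)"

definition col :: "(nat \<Rightarrow> int) \<Rightarrow> monomial" where
  "col c = (\<Prod>k\<in>{1..\<l>}. box n (c k) (int \<l> + 1 - 2 * int k))"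

text \<open>
  The box number \<open>k\<close> of \<open>c\<close> contributes a positive power of a variable at this level and a negative power
  one level higher.
\<close>

definition level :: "(nat \<Rightarrow> int) \<Rightarrow> nat \<Rightarrow> int" where
  "level c k = int \<l> - 2 * int k + c k"

lemma col_cong: "(\<And>k. k \<in> {1..\<l>} \<Longrightarrow> c k = c' k) \<Longrightarrow> col c = col c'"
  unfolding col_def by (rule prod.cong) auto

lemma wt_col: "wt (col c) x = (\<Sum>k\<in>{1..\<l>}. box_weight n (c k) x)"
  by (simp add: col_def wt_prod wt_box)

lemma expo_col:
  "expo (col c) i l =
     (\<Sum>k\<in>{1..\<l>}. of_bool (int i = c k mod N \<and> l = level c k))
     - (\<Sum>k\<in>{1..\<l>}. of_bool (int i = (c k - 1) mod N \<and> l = level c k + 1))"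
  unfolding col_def expo_prod expo_box sum_subtractf level_def
  by (intro arg_cong2[of _ _ _ _ minus] sum.cong refl) (auto simp: algebra_simps)

lemma mod_N_eqD:
  assumes "a mod N = b mod N" "\<bar>a - b\<bar> < N"
  shows "a = b"
proof (rule ccontr)
  assume "a \<noteq> b"
  moreover have "N dvd a - b" using assms(1) by (simp add: mod_eq_dvd_iff)
  ultimately have "\<bar>N\<bar> \<le> \<bar>a - b\<bar>" by (intro dvd_imp_le_int) auto
  with assms(2) show False by simp
qed

lemma pred_mod_N_iff: "(a - 1) mod N = b mod N \<longleftrightarrow> a mod N = (b + 1) mod N"
  by (simp add: mod_eq_dvd_iff algebra_simps)

lemma succ_mod_N_neq: "(a + 1) mod N \<noteq> a mod N"
  using mod_N_eqD[of "a + 1" a] n by auto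

lemma nat_mod_N: "int (nat (a mod N)) = a mod N" "nat (a mod N) \<le> n"
  using pos_mod_sign[of N a] pos_mod_bound[of N a] by linarith+

lemma columnD: "column c \<Longrightarrow> j \<in> {1..\<l>} \<Longrightarrow> k \<in> {1..\<l>} \<Longrightarrow> j < k \<Longrightarrow> c j < c k \<and> c k < c j + N"
  by (simp add: column_def)

lemma column_residues_distinct:
  assumes "column c" "j \<in> {1..\<l>}" "k \<in> {1..\<l>}"
  shows "c j mod N = c k mod N \<longleftrightarrow> j = k"
proof (cases j k rule: linorder_cases)
  case less
  with columnD[OF assms] mod_N_eqD[of "c j" "c k"] show ?thesis by auto
next
  case greater
  with columnD[OF assms(1,3,2)] mod_N_eqD[of "c j" "c k"] show ?thesis by auto
qed simp

text \<open>
  By distinctness of the residues, each of the two sums in \<open>expo_col\<close> has at most one non-zero term.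
\<close>

lemma expo_pos_part:
  assumes "column c" "k \<in> {1..\<l>}" "int i = c k mod N"
  shows "(\<Sum>k\<in>{1..\<l>}. of_bool (int i = c k mod N \<and> l = level c k) :: int) = of_bool (l = level c k)"
  by (rule sum_of_bool_unique) (use assms column_residues_distinct in auto)

lemma expo_neg_part:
  assumes "column c" "k \<in> {1..\<l>}" "int i = (c k - 1) mod N"
  shows "(\<Sum>k\<in>{1..\<l>}. of_bool (int i = (c k - 1) mod N \<and> l = level c k + 1) :: int) = of_bool (l = level c k + 1)"
proof (rule sum_of_bool_unique)
  fix j assume j: "j \<in> {1..\<l>}"
  have "int i = (c j - 1) mod N \<longleftrightarrow> c j mod N = c k mod N"
    using assms(3) pred_mod_N_iff[of "c j" "c k - 1"] by auto
  then show "int i = (c j - 1) mod N \<longleftrightarrow> j = k"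
    using column_residues_distinct[OF assms(1) j assms(2)] by simp
qed (use assms in auto)

lemma col_update:
  assumes "k \<in> {1..\<l>}"
  shows "col (c(k := v)) = (\<Prod>j\<in>{1..\<l>} - {k}. box n (c j) (int \<l> + 1 - 2 * int j)) * box n v (int \<l> + 1 - 2 * int k)"
proof -
  let ?f = "\<lambda>c j. box n (c j) (int \<l> + 1 - 2 * int j)"
  have "col (c(k := v)) = ?f (c(k := v)) k * prod (?f (c(k := v))) ({1..\<l>} - {k})"
    unfolding col_def by (rule prod.remove) (use assms in auto)
  also have "prod (?f (c(k := v))) ({1..\<l>} - {k}) = prod (?f c) ({1..\<l>} - {k})"
    by (rule prod.cong) auto
  finally show ?thesis by (simp only: mult.commute fun_upd_same)
qed

lemma col_step:
  assumes "k \<in> {1..\<l>}"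
  shows "col c = col (c(k := c k + 1)) * A n (nat (c k mod N)) (level c k + 1)"
proof -
  have lev: "int \<l> + 1 - 2 * int k + c k = level c k + 1" by (simp add: level_def)
  have "col c = col (c(k := c k))" by simp
  also have "\<dots> = col (c(k := c k + 1)) * A n (nat (c k mod N)) (level c k + 1)"
    unfolding col_update[OF assms] box_step[OF n, of "c k" "int \<l> + 1 - 2 * int k"] lev
    by (simp only: mult.assoc)
  finally show ?thesis .
qed

section \<open>The operators on columns\<close>

lemma advance_box:
  assumes c: "column c" and k: "k \<in> {1..\<l>}"
    and free: "\<And>j. j \<in> {1..\<l>} \<Longrightarrow> c j mod N \<noteq> (c k + 1) mod N"
  shows "column (c(k := c k + 1))"
    and "f_op n (nat (c k mod N)) (col c) = Some (col (c(k := c k + 1)))"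
    and "e_op n (nat (c k mod N)) (col c) = None"
proof -
  let ?i = "nat (c k mod N)"
  have free': "c j \<noteq> c k + 1" "c k + 1 \<noteq> c j + N" if "j \<in> {1..\<l>}" for j
    using free[OF that] mod_add_self2[of "c j" N] by metis+
  show "column (c(k := c k + 1))"
    unfolding column_def
  proof (intro ballI impI)
    fix i j assume ij: "i \<in> {1..\<l>}" "j \<in> {1..\<l>}" "i < j"
    show "(c(k := c k + 1)) i < (c(k := c k + 1)) j \<and> (c(k := c k + 1)) j < (c(k := c k + 1)) i + N"
      using columnD[OF c ij] free'[OF ij(1)] free'[OF ij(2)] ij(3) by auto
  qed
  have "(\<Sum>j\<in>{1..\<l>}. of_bool (int ?i = (c j - 1) mod N \<and> l = level c j + 1) :: int) = 0" for l
  proof (intro sum.neutral ballI)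
    fix j assume "j \<in> {1..\<l>}"
    from free[OF this] have "(c j - 1) mod N \<noteq> c k mod N" by (simp add: pred_mod_N_iff)
    then show "of_bool (int ?i = (c j - 1) mod N \<and> l = level c j + 1) = (0 :: int)"
      by (auto simp: nat_mod_N)
  qed
  then have "expo (col c) ?i l = of_bool (l = level c k)" for l
    unfolding expo_col using expo_pos_part[OF c k, of ?i l] by (simp add: nat_mod_N)
  note s = string_plus[of "col c" ?i "level c k", OF this]
  have "col c * inverse (A n ?i (level c k + 1)) = col (c(k := c k + 1))"
    by (subst col_step[OF k, of c]) (simp add: mult.assoc monomial_right_inverse)
  then show "f_op n ?i (col c) = Some (col (c(k := c k + 1)))"
    by (simp add: f_op_def s)
  show "e_op n ?i (col c) = None" by (simp add: e_op_def s)
qed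

lemma retract_box:
  assumes c: "column c" and k: "k \<in> {1..\<l>}"
    and free: "\<And>j. j \<in> {1..\<l>} \<Longrightarrow> c j mod N \<noteq> (c k - 1) mod N"
  shows "column (c(k := c k - 1))"
    and "e_op n (nat ((c k - 1) mod N)) (col c) = Some (col (c(k := c k - 1)))"
    and "f_op n (nat ((c k - 1) mod N)) (col c) = None"
proof -
  let ?i = "nat ((c k - 1) mod N)"
  have free': "c j \<noteq> c k - 1" "c k - 1 + N \<noteq> c j" if "j \<in> {1..\<l>}" for j
    using free[OF that] mod_add_self2[of "c k - 1" N] by auto
  show "column (c(k := c k - 1))"
    unfolding column_def
  proof (intro ballI impI)
    fix i j assume ij: "i \<in> {1..\<l>}" "j \<in> {1..\<l>}" "i < j"
    show "(c(k := c k - 1)) i < (c(k := c k - 1)) j \<and> (c(k := c k - 1)) j < (c(k := c k - 1)) i + N"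
      using columnD[OF c ij] free'[OF ij(1)] free'[OF ij(2)] ij(3) by auto
  qed
  have "(\<Sum>j\<in>{1..\<l>}. of_bool (int ?i = c j mod N \<and> l = level c j) :: int) = 0" for l
  proof (intro sum.neutral ballI)
    fix j assume "j \<in> {1..\<l>}"
    from free[OF this] show "of_bool (int ?i = c j mod N \<and> l = level c j) = (0 :: int)"
      by (auto simp: nat_mod_N)
  qed
  then have "expo (col c) ?i l = - of_bool (l = level c k + 1)" for l
    unfolding expo_col using expo_neg_part[OF c k, of ?i l] by (simp add: nat_mod_N)
  note s = string_minus[of "col c" ?i "level c k + 1", OF this]
  have "col c * A n ?i (level c k) = col (c(k := c k - 1))"
    using col_step[OF k, of "c(k := c k - 1)"] by (simp add: level_def add_diff_eq)
  then show "e_op n ?i (col c) = Some (col (c(k := c k - 1)))"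
    by (simp add: e_op_def s)
  show "f_op n ?i (col c) = None" by (simp add: f_op_def s)
qed

text \<open>
  Two boxes whose entries are adjacent modulo \<open>N\<close> are consecutive in the column, and then the
  positive power of the one and the negative power of the other are at the same level, or they are the
  last and the first box, and then these levels differ by \<open>N - 2 \<l> \<ge> 0\<close>.
\<close>

lemma adjacent_boxes_level:
  assumes c: "column c" and j: "j \<in> {1..\<l>}" and k: "k \<in> {1..\<l>}"
    and adj: "c k mod N = (c j + 1) mod N"
  shows "level c k + 1 \<le> level c j"
proof (cases j k rule: linorder_cases)
  case less
  with c j k have "c j < c k" "c k < c j + N" by (auto simp: column_def)
  with mod_N_eqD[OF adj] have ck: "c k = c j + 1" by auto
  have "k = j + 1"
  proof (rule ccontr)
    assume "k \<noteq> j + 1"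
    with less j k have "j + 1 \<in> {1..\<l>}" "j < j + 1" "j + 1 < k" by auto
    with c j k have "c j < c (j + 1)" "c (j + 1) < c k" by (auto simp: column_def)
    with ck show False by simp
  qed
  with ck show ?thesis by (simp add: level_def)
next
  case equal
  with adj succ_mod_N_neq[of "c j"] show ?thesis by simp
next
  case greater
  with c j k have lt: "c k < c j" "c j < c k + N" by (auto simp: column_def)
  have "(c k + N) mod N = (c j + 1) mod N" using adj by simp
  then have "c k + N = c j + 1" by (rule mod_N_eqD) (use lt in auto)
  moreover have "int j - int k \<le> int \<l> - 1" using j k by auto
  ultimately show ?thesis using l by (simp add: level_def)
qed

lemma blocked_boxes:
  assumes c: "column c" and j: "j \<in> {1..\<l>}" and k: "k \<in> {1..\<l>}"
    and adj: "c k mod N = (c j + 1) mod N"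
  shows "e_op n (nat (c j mod N)) (col c) = None"
    and "f_op n (nat (c j mod N)) (col c) = None"
proof -
  let ?i = "nat (c j mod N)"
  have "int ?i = (c k - 1) mod N"
    using adj pred_mod_N_iff[of "c k" "c j"] by (simp add: nat_mod_N)
  then have "expo (col c) ?i l = of_bool (l = level c j) - of_bool (l = level c k + 1)" for l
    unfolding expo_col using expo_pos_part[OF c j, of ?i l] expo_neg_part[OF c k, of ?i l]
    by (simp add: nat_mod_N)
  note s = string_minus_plus[of "col c" ?i, OF this adjacent_boxes_level[OF assms]]
  show "e_op n ?i (col c) = None" "f_op n ?i (col c) = None"
    by (simp_all add: e_op_def f_op_def s)
qed

lemma absent_boxes:
  assumes "i \<le> n" "\<And>j. j \<in> {1..\<l>} \<Longrightarrow> c j mod N \<noteq> int i"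
    and "\<And>j. j \<in> {1..\<l>} \<Longrightarrow> (c j - 1) mod N \<noteq> int i"
  shows "e_op n i (col c) = None" and "f_op n i (col c) = None"
proof -
  have "expo (col c) i l = of_bool (l = 0) - of_bool (l = 0)" for l
  proof -
    have "(\<Sum>k\<in>{1..\<l>}. of_bool (int i = c k mod N \<and> l = level c k) :: int) = 0"
      using assms(2) by (intro sum.neutral) force
    moreover have "(\<Sum>k\<in>{1..\<l>}. of_bool (int i = (c k - 1) mod N \<and> l = level c k + 1) :: int) = 0"
      using assms(3) by (intro sum.neutral) force
    ultimately show ?thesis unfolding expo_col by simp
  qed
  note s = string_minus_plus[of "col c" i, OF this order.refl]
  show "e_op n i (col c) = None" "f_op n i (col c) = None"
    by (simp_all add: e_op_def f_op_def s)
qed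

text \<open>
  Conversely, every non-zero value of an operator on a column arises by moving one box, since the
  remaining configurations are excluded by \<open>blocked_boxes\<close> and \<open>absent_boxes\<close>.
\<close>

lemma f_op_colD:
  assumes c: "column c" and i: "i \<le> n" and f: "f_op n i (col c) = Some m"
  obtains k where "k \<in> {1..\<l>}" "c k mod N = int i" "column (c(k := c k + 1))" "m = col (c(k := c k + 1))"
proof (cases "\<exists>k\<in>{1..\<l>}. c k mod N = int i")
  case True
  then obtain k where k: "k \<in> {1..\<l>}" "c k mod N = int i" by auto
  then have i': "i = nat (c k mod N)" by simp
  have free: "c j mod N \<noteq> (c k + 1) mod N" if "j \<in> {1..\<l>}" for j
    using blocked_boxes(2)[OF c k(1) that] f i' by auto
  show ?thesis using that[OF k] advance_box(1,2)[OF c k(1) free] f i' by auto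
next
  case False
  show ?thesis
  proof (cases "\<exists>k\<in>{1..\<l>}. (c k - 1) mod N = int i")
    case True
    then obtain k where k: "k \<in> {1..\<l>}" "(c k - 1) mod N = int i" by auto
    have "f_op n (nat ((c k - 1) mod N)) (col c) = None"
      by (rule retract_box(3)[OF c k(1)]) (use False k in auto)
    with f k show ?thesis by simp
  qed (use False absent_boxes(2)[OF i, of c] f in auto)
qed

lemma e_op_colD:
  assumes c: "column c" and i: "i \<le> n" and e: "e_op n i (col c) = Some m"
  obtains k where "k \<in> {1..\<l>}" "(c k - 1) mod N = int i" "column (c(k := c k - 1))" "m = col (c(k := c k - 1))"
proof (cases "\<exists>k\<in>{1..\<l>}. (c k - 1) mod N = int i")
  case True
  then obtain k where k: "k \<in> {1..\<l>}" "(c k - 1) mod N = int i" by auto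
  then have i': "i = nat ((c k - 1) mod N)" by simp
  have free: "c j mod N \<noteq> (c k - 1) mod N" if j: "j \<in> {1..\<l>}" for j
  proof
    assume j': "c j mod N = (c k - 1) mod N"
    then have "c k mod N = (c j + 1) mod N" using pred_mod_N_iff[of "c k" "c j"] by simp
    from blocked_boxes(1)[OF c j k(1) this] show False using e i' j' by simp
  qed
  show ?thesis using that[OF k] retract_box(1,2)[OF c k(1) free] e i' by auto
next
  case False
  show ?thesis
  proof (cases "\<exists>k\<in>{1..\<l>}. c k mod N = int i")
    case True
    then obtain k where k: "k \<in> {1..\<l>}" "c k mod N = int i" by auto
    have "e_op n (nat (c k mod N)) (col c) = None"
    proof (rule advance_box(3)[OF c k(1)])
      fix j assume "j \<in> {1..\<l>}"
      with False k(2) show "c j mod N \<noteq> (c k + 1) mod N"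
        using pred_mod_N_iff[of "c j" "c k"] by auto
    qed
    with e k show ?thesis by simp
  qed (use False absent_boxes(1)[OF i, of c] e in auto)
qed

lemma column_edge:
  assumes c: "column c" and k: "k \<in> {1..\<l>}" and c': "column (c(k := c k + 1))"
  shows "f_op n (nat (c k mod N)) (col c) = Some (col (c(k := c k + 1)))"
    and "e_op n (nat (c k mod N)) (col (c(k := c k + 1))) = Some (col c)"
proof -
  let ?c = "c(k := c k + 1)"
  show "f_op n (nat (c k mod N)) (col c) = Some (col ?c)"
  proof (rule advance_box(2)[OF c k])
    fix j assume "j \<in> {1..\<l>}"
    with column_residues_distinct[OF c' _ k, of j] succ_mod_N_neq[of "c k"]
    show "c j mod N \<noteq> (c k + 1) mod N" by (cases "j = k") auto
  qed
  have "e_op n (nat ((?c k - 1) mod N)) (col ?c) = Some (col (?c(k := ?c k - 1)))"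
  proof (rule retract_box(2)[OF c' k])
    fix j assume "j \<in> {1..\<l>}"
    with column_residues_distinct[OF c _ k, of j] succ_mod_N_neq[of "c k"]
    show "?c j mod N \<noteq> (?c k - 1) mod N" by (cases "j = k") auto
  qed
  then show "e_op n (nat (c k mod N)) (col ?c) = Some (col c)" by simp
qed

section \<open>Windows and connectedness\<close>

definition window :: "int \<Rightarrow> (nat \<Rightarrow> int) \<Rightarrow> bool" where
  "window a c \<longleftrightarrow> (\<forall>k\<in>{1..\<l>}. a < c k \<and> c k \<le> a + N)"

definition corner :: "int \<Rightarrow> nat \<Rightarrow> int" where
  "corner a k = a + int k"

lemma column_corner: "column (corner a)"
  using l by (auto simp: column_def corner_def)

lemma window_corner: "window a (corner a)" "window a (corner (a + 1))"
  using l n by (auto simp: window_def corner_def)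

text \<open>
  In a column of the window other than the corner, the first entry exceeding its value in
  the corner can be lowered: its predecessor is free, and the index of the operator used
  is not \<open>a\<close>, as this predecessor still lies in the window.  Iterating reaches the corner.
  Each step can be undone, so \<open>m\<close> reaches the column if and only if it reaches the corner.
\<close>

lemma window_connected:
  assumes "column c" "window a c" and J: "{0..n} - {nat (a mod N)} \<subseteq> J"
  shows "col c \<in> subcrystal n J m \<longleftrightarrow> col (corner a) \<in> subcrystal n J m"
  using assms(1,2)
proof (induction c rule: measure_induct_rule[of "\<lambda>c. nat (\<Sum>k\<in>{1..\<l>}. c k - a)"])
  case (less c)
  note c = less.prems(1) and w = less.prems(2)
  show ?case
  proof (cases "\<forall>k\<in>{1..\<l>}. c k = a + int k")
    case True
    then have "col c = col (corner a)" by (intro col_cong) (auto simp: corner_def)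
    then show ?thesis by simp
  next
    case False
    define k where "k = (LEAST k. k \<in> {1..\<l>} \<and> c k \<noteq> a + int k)"
    from False have "\<exists>k. k \<in> {1..\<l>} \<and> c k \<noteq> a + int k" by blast
    from LeastI_ex[OF this] have k: "k \<in> {1..\<l>}" "c k \<noteq> a + int k"
      unfolding k_def by blast+
    have below: "c j = a + int j" if "j \<in> {1..\<l>}" "j < k" for j
      using not_less_Least[of j "\<lambda>k. k \<in> {1..\<l>} \<and> c k \<noteq> a + int k"] that by (auto simp: k_def)
    have gt: "c k > a + int k"
    proof (cases "k = 1")
      case True
      moreover have "a < c k" using w k(1) by (auto simp: window_def)
      ultimately show ?thesis using k(2) by simp
    next
      case False
      with k have "k - 1 \<in> {1..\<l>}" "k - 1 < k" by auto
      then have "c (k - 1) = a + int (k - 1)" "c (k - 1) < c k"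
        using below columnD[OF c _ k(1), of "k - 1"] by blast+
      with k False show ?thesis by (auto simp: of_nat_diff)
    qed
    define d where "d = c(k := c k - 1)"
    have "c k \<le> a + N" using w k(1) unfolding window_def by blast
    then have wk: "a < c k - 1" "c k - 1 < a + N" using gt k(1) by auto
    have "c j mod N \<noteq> (c k - 1) mod N" if j: "j \<in> {1..\<l>}" for j
    proof
      assume eq: "c j mod N = (c k - 1) mod N"
      have "a < c j" "c j \<le> a + N" using w j by (auto simp: window_def)
      with wk have "c j = c k - 1" by (intro mod_N_eqD[OF eq]) auto
      moreover have "c j > c k" if "k < j" using that c j k by (auto simp: column_def)
      ultimately show False using below[OF j] gt by (cases j k rule: linorder_cases) auto
    qed
    then have d: "column d" using retract_box(1)[OF c k(1)] by (simp add: d_def)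
    have cd: "c = d(k := d k + 1)" by (simp add: d_def)
    have dw: "window a d" using w wk k by (auto simp: window_def d_def)
    have iJ: "nat (d k mod N) \<in> J"
    proof -
      have "d k mod N \<noteq> a mod N" using mod_N_eqD[of "d k" a] wk by (auto simp: d_def)
      then have "nat (d k mod N) \<noteq> nat (a mod N)" by (metis nat_mod_N(1))
      with J nat_mod_N(2)[of "d k"] show ?thesis by auto
    qed
    note edge = column_edge[OF d k(1), folded cd, OF c]
    have "col c \<in> subcrystal n J m \<longleftrightarrow> col d \<in> subcrystal n J m"
      using subcrystal.e_step[OF _ iJ edge(2)] subcrystal.f_step[OF _ iJ edge(1)] by blast
    moreover have "nat (\<Sum>k\<in>{1..\<l>}. d k - a) < nat (\<Sum>k\<in>{1..\<l>}. c k - a)"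
    proof -
      have "(\<Sum>k\<in>{1..\<l>}. d k - a) < (\<Sum>k\<in>{1..\<l>}. c k - a)"
        by (rule sum_strict_mono_ex1) (use k in \<open>auto simp: d_def\<close>)
      moreover have "0 \<le> (\<Sum>k\<in>{1..\<l>}. d k - a)"
      proof (rule sum_nonneg)
        fix j assume "j \<in> {1..\<l>}"
        with dw have "a < d j" unfolding window_def by blast
        then show "0 \<le> d j - a" by simp
      qed
      ultimately show ?thesis by simp
    qed
    ultimately show ?thesis using less.IH[OF _ d dw] by simp
  qed
qed

text \<open>
  Leaving the window means moving an entry from \<open>a + N\<close> to \<open>a + N + 1\<close> or from \<open>a + 1\<close> to \<open>a\<close>; both
  moves have index \<open>a\<close> modulo \<open>N\<close>, which is excluded here.
\<close>

lemma subcrystal_corner: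
  "subcrystal n ({0..n} - {nat (a mod N)}) (col (corner a)) = {col c | c. column c \<and> window a c}"
proof (intro equalityI subsetI)
  fix m assume "m \<in> subcrystal n ({0..n} - {nat (a mod N)}) (col (corner a))"
  then show "m \<in> {col c | c. column c \<and> window a c}"
  proof induction
    case base
    show ?case using column_corner window_corner by blast
  next
    case (e_step m' i m'')
    then obtain c where c: "m' = col c" "column c" "window a c" by auto
    from e_step have i: "i \<le> n" "i \<noteq> nat (a mod N)" by auto
    from e_op_colD[OF c(2) i(1) e_step(3)[unfolded c(1)]] obtain k where
      k: "k \<in> {1..\<l>}" "(c k - 1) mod N = int i" "column (c(k := c k - 1))" "m'' = col (c(k := c k - 1))" .
    have "c k - 1 \<noteq> a" using i k(2) by auto
    then have "window a (c(k := c k - 1))" using c(3) k(1) by (force simp: window_def)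
    with k show ?case by blast
  next
    case (f_step m' i m'')
    then obtain c where c: "m' = col c" "column c" "window a c" by auto
    from f_step have i: "i \<le> n" "i \<noteq> nat (a mod N)" by auto
    from f_op_colD[OF c(2) i(1) f_step(3)[unfolded c(1)]] obtain k where
      k: "k \<in> {1..\<l>}" "c k mod N = int i" "column (c(k := c k + 1))" "m'' = col (c(k := c k + 1))" .
    have "c k \<noteq> a + N" using i k(2) by auto
    then have "window a (c(k := c k + 1))" using c(3) k(1) by (force simp: window_def)
    with k show ?case by blast
  qed
next
  fix m assume "m \<in> {col c | c. column c \<and> window a c}"
  then show "m \<in> subcrystal n ({0..n} - {nat (a mod N)}) (col (corner a))"
    using window_connected subcrystal.base by blast
qed

lemma window_exists: "column c \<Longrightarrow> window (c 1 - 1) c"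
proof -
  assume c: "column c"
  have "c 1 - 1 < c k \<and> c k \<le> c 1 - 1 + N" if "k \<in> {1..\<l>}" for k
    using columnD[OF c _ that, of 1] that l(1) by (cases "k = 1") auto
  then show ?thesis by (simp add: window_def)
qed

text \<open>
  The corner of \<open>a + 1\<close> also lies in the window of \<open>a\<close>, because \<open>\<l> < N\<close>; this links all corners,
  in both directions.
\<close>

lemma crystal_corner: "crystal n (col (corner 0)) = {col c | c. column c}"
proof (intro equalityI subsetI)
  fix m assume "m \<in> crystal n (col (corner 0))"
  then show "m \<in> {col c | c. column c}"
    unfolding crystal_def
  proof induction
    case base
    show ?case using column_corner by blast
  next
    case (e_step m' i m'')
    then show ?case by (auto elim: e_op_colD)
  next
    case (f_step m' i m'')
    then show ?case by (auto elim: f_op_colD)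
  qed
next
  have step: "col (corner (a + 1)) \<in> crystal n (col (corner 0)) \<longleftrightarrow> col (corner a) \<in> crystal n (col (corner 0))" for a
    unfolding crystal_def by (rule window_connected) (auto simp: column_corner window_corner)
  have corners: "col (corner a) \<in> crystal n (col (corner 0))" for a
  proof (induction a rule: int_induct[of _ 0])
    case base
    show ?case unfolding crystal_def by (rule subcrystal.base)
  next
    case (step1 i)
    then show ?case using step[of i] by simp
  next
    case (step2 i)
    then show ?case using step[of "i - 1"] by simp
  qed
  fix m assume "m \<in> {col c | c. column c}"
  then obtain c where c: "m = col c" "column c" by auto
  show "m \<in> crystal n (col (corner 0))"
    using window_connected[OF c(2) window_exists[OF c(2)], of "{0..n}"] corners c(1)
    by (auto simp: crystal_def)
qed

section \<open>Exponents and weights of the corners\<close>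

lemma corner_telescope:
  "(\<Sum>k\<in>{1..q}. expo (box n (corner a k) (int \<l> + 1 - 2 * int k)) i x)
     = expo (Y n (int q + a) (int \<l> + a - int q) * inverse (Y n a (int \<l> + a))) i x"
proof (induction q)
  case 0
  show ?case by (simp add: expo_simps)
next
  case (Suc q)
  have "int \<l> + 1 - 2 * int (Suc q) + corner a (Suc q) = int \<l> + a - int q"
    "corner a (Suc q) - 1 = int q + a" by (simp_all add: corner_def)
  then show ?case using Suc by (simp add: expo_simps expo_box expo_Y) (simp add: corner_def algebra_simps)
qed

lemma expo_corner:
  "expo (col (corner a)) = expo (Y n (int \<l> + a) a * inverse (Y n a (int \<l> + a)))"
  by (intro ext) (simp only: col_def expo_prod corner_telescope, simp)

lemma base_eq_corner: "base_monomial n \<l> = col (corner 0)"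
proof (rule monomial_eqI)
  show "expo (base_monomial n \<l>) i x = expo (col (corner 0)) i x" for i x
    unfolding expo_corner by (simp add: base_monomial_def expo_simps)
  have "(\<Sum>k\<in>{1..q}. box_weight n (corner 0 k) x) = varpi q x" if "q \<le> n" for q x
    using that
  proof (induction q)
    case 0
    show ?case by (simp add: varpi_def)
  next
    case (Suc q)
    then have "int q mod N = int q" "(int q + 1) mod N = int q + 1" "int q div N = 0" by simp_all
    then show ?case using Suc by (auto simp: varpi_def fund_weight_def box_weight_def corner_def split: cobasis.splits)
  qed
  then show "wt (base_monomial n \<l>) x = wt (col (corner 0)) x" for x
    using l n by (simp add: base_monomial_def wt_simps wt_col)
qed

text \<open>
  The values at \<open>H j\<close> are sums of exponents.  For the value at \<open>D\<close>, pair the exponents with the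
  quadratic function \<open>x\<^sup>2 + i\<^sup>2 - N i\<close> of \<open>Y\<^bsub>i,x\<^esub>\<close>, for \<open>0 \<le> i \<le> n\<close>.  Its value on \<open>A\<^bsub>i,x\<^esub>\<close> is \<open>0\<close> for \<open>i \<noteq> 0\<close>,
  as \<open>x\<^sup>2\<close> and \<open>i\<^sup>2\<close> have the same second difference, and \<open>2 N\<close> for \<open>i = 0\<close>.  So up to a constant the
  pairing is \<open>2 N\<close> times the value of the weight at \<open>D\<close>.
\<close>

lemma wt_col_determined:
  assumes "expo (col c) = expo (col c')"
  shows "wt (col c) = wt (col c')"
proof
  define a b where "a = (\<lambda>c k. (nat (c k mod N), level c k))"
    and "b = (\<lambda>c k. (nat ((c k - 1) mod N), level c k + 1))"
  have nat_eq: "i = nat (x mod N) \<longleftrightarrow> int i = x mod N" for i x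
    using nat_mod_N(1)[of x] by auto
  have expo_pair: "expo (col c) (fst p) (snd p) = (\<Sum>k\<in>{1..\<l>}. of_bool (p = a c k) - of_bool (p = b c k))" for c p
    by (cases p) (simp add: expo_col a_def b_def nat_eq sum_subtractf)
  have pairing: "(\<Sum>k\<in>{1..\<l>}. Q (a c k) - Q (b c k)) = (\<Sum>k\<in>{1..\<l>}. Q (a c' k) - Q (b c' k))" for Q :: "nat \<times> int \<Rightarrow> int"
    by (rule signed_delta_sum_pairing) (simp, simp only: expo_pair[symmetric] assms)
  fix x
  show "wt (col c) x = wt (col c') x"
  proof (cases x)
    case (H j)
    have "wt (col c) x = of_int (\<Sum>k\<in>{1..\<l>}. of_bool (fst (a c k) = j) - of_bool (fst (b c k) = j))" for c
      by (simp add: wt_col H box_weight_def a_def b_def eq_commute[of _ j] nat_eq)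
    then show ?thesis using pairing[of "\<lambda>p. of_bool (fst p = j)"] by (simp only:)
  next
    case D
    define Q :: "nat \<times> int \<Rightarrow> int" where "Q = (\<lambda>(i, x). x^2 + (int i)^2 - N * int i)"
    have Q: "Q (a c k) - Q (b c k) = - 2 * N * ((c k - 1) div N) - 2 * (int \<l> - 2 * int k) - 2 - N" for c k
    proof -
      define q t where "q = (c k - 1) div N" and "t = (c k - 1) mod N"
      have ck: "c k - 1 = t + N * q" by (simp add: q_def t_def)
      have t: "0 \<le> t" "t \<le> int n" using nat_mod_N[of "c k - 1"] by (simp_all add: t_def)
      have "c k mod N = (if t = int n then 0 else t + 1)"
        using mod_succ[of "c k - 1" n] by (simp add: t_def)
      \<comment> \<open>The polynomial \<open>i\<^sup>2 - N i\<close> takes the same value at \<open>0\<close> and \<open>N\<close>, so reducing \<open>t + 1\<close> has no effect.\<close>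
      then have "(int (nat (c k mod N)))^2 - N * int (nat (c k mod N)) = (t + 1)^2 - N * (t + 1)"
        unfolding nat_mod_N by (auto simp: power2_eq_square algebra_simps)
      moreover have "int (nat ((c k - 1) mod N)) = t" by (simp add: nat_mod_N t_def)
      ultimately have "Q (a c k) - Q (b c k) =
          (level c k)^2 + ((t + 1)^2 - N * (t + 1)) - ((level c k + 1)^2 + t^2 - N * t)"
        using t by (simp add: Q_def a_def b_def)
      also have "\<dots> = 2 * t - 2 * level c k - N"
        by (simp add: power2_eq_square algebra_simps)
      also have "level c k = int \<l> - 2 * int k + t + N * q + 1"
        using ck by (simp add: level_def)
      finally show ?thesis unfolding q_def[symmetric] by (simp add: algebra_simps)
    qed
    have "(\<Sum>k\<in>{1..\<l>}. Q (a c k) - Q (b c k)) =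
       - 2 * N * (\<Sum>k\<in>{1..\<l>}. (c k - 1) div N) - (\<Sum>k\<in>{1..\<l>}. 2 * (int \<l> - 2 * int k) + 2 + N)" for c
      unfolding Q sum_distrib_left sum_subtractf[symmetric] by (rule sum.cong) auto
    with pairing[of Q] have "(\<Sum>k\<in>{1..\<l>}. (c k - 1) div N) = (\<Sum>k\<in>{1..\<l>}. (c' k - 1) div N)"
      by auto
    moreover have "wt (col c) D = - of_int (\<Sum>k\<in>{1..\<l>}. (c k - 1) div N)" for c
      by (simp add: wt_col box_weight_def sum_negf)
    ultimately show ?thesis by (simp only: D)
  qed
qed

text \<open>All elements of the crystal are columns, so the previous lemma makes the description unique.\<close>

lemma with_weight_col:
  assumes "column c" "expo y = expo (col c)"
  shows "with_weight n \<l> y = col c"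
  unfolding with_weight_def base_eq_corner crystal_corner
proof (rule the_equality)
  fix m assume "m \<in> {col c | c. column c} \<and> expo m = expo y"
  then show "m = col c"
    using assms(2) wt_col_determined[of _ c] by (auto intro: monomial.expand)
qed (use assms in auto)

lemma corner_monomial_eq: "corner_monomial n \<l> j = col (corner (int j))"
  unfolding corner_monomial_def by (rule with_weight_col[OF column_corner]) (simp add: expo_corner)

section \<open>The shift and the decomposition\<close>

lemma tau_col: "tau n \<l> (col c) = col (\<lambda>k. c k + N)"
proof (rule monomial_eqI)
  have "box_weight n (i + N) x = box_weight n i x - null_root n x" for i x
  proof -
    have "(i + N - 1) mod N = (i - 1) mod N" "(i + N - 1) div N = (i - 1) div N + 1"
      using mod_add_self2[of "i - 1" N] div_add_self2[of N "i - 1"] by (simp_all add: algebra_simps)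
    then show ?thesis by (simp add: null_root_apply[OF n] box_weight_def split: cobasis.split)
  qed
  then show "wt (tau n \<l> (col c)) x = wt (col (\<lambda>k. c k + N)) x" for x
    by (simp add: tau_def shift_def wt_col sum_subtractf)
  have "(c k + N - 1) mod N = (c k - 1) mod N" for k
    using mod_add_self2[of "c k - 1" N] by (simp add: algebra_simps)
  moreover have "level (\<lambda>k. c k + N) k = level c k + N" for k by (simp add: level_def)
  ultimately show "expo (tau n \<l> (col c)) i x = expo (col (\<lambda>k. c k + N)) i x" for i x
    by (simp add: tau_def shift_def expo_col) (simp add: algebra_simps)
qed

lemma inj_tau: "inj (tau n \<l>)"
proof (rule injI)
  fix m m' assume eq: "tau n \<l> m = tau n \<l> m'"
  have "wt m x = wt m' x" for x
    using arg_cong[OF eq, of "\<lambda>m. wt m x"] by (simp add: tau_def shift_def)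
  moreover have "expo m i x = expo m' i x" for i x
    using arg_cong[OF eq, of "\<lambda>m. expo m i (x + N)"] by (simp add: tau_def shift_def)
  ultimately show "m = m'" by (rule monomial_eqI)
qed

lemma int_funpow_tau_col: "int_funpow (tau n \<l>) z (col c) = col (\<lambda>k. c k + z * N)"
proof -
  have pos: "(tau n \<l> ^^ q) (col c) = col (\<lambda>k. c k + int q * N)" for q
    by (induction q) (simp_all add: tau_col algebra_simps)
  have inv_tau: "inv (tau n \<l>) (col c) = col (\<lambda>k. c k - N)" for c
    using tau_col[of "\<lambda>k. c k - N"] by (simp add: inv_f_eq inj_tau)
  have neg: "(inv (tau n \<l>) ^^ q) (col c) = col (\<lambda>k. c k - int q * N)" for q
    by (induction q) (simp_all add: inv_tau algebra_simps)
  show ?thesis using pos[of "nat z"] neg[of "nat (- z)"] by (simp add: int_funpow_def)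
qed

lemma column_shift: "column (\<lambda>k. c k + z) \<longleftrightarrow> column c"
  by (simp add: column_def)

text \<open>
  A column in the window of \<open>a\<close> is the translate by \<open>N * (a div N)\<close> of a column in the window of
  \<open>a mod N\<close>, and the latter is one of \<open>0, \<dots>, n\<close>.
\<close>

theorem crystal_eq_union_of_windows:
  "crystal n (base_monomial n \<l>) =
    (\<Union>k::int. int_funpow (tau n \<l>) k `
       (\<Union>j\<in>{0..n}. subcrystal n ({0..n} - {j}) (corner_monomial n \<l> j)))"
proof -
  have sub: "subcrystal n ({0..n} - {j}) (corner_monomial n \<l> j) = {col c | c. column c \<and> window (int j) c}"
    if "j \<in> {0..n}" for j
    using subcrystal_corner[of "int j"] that by (simp add: corner_monomial_eq)
  have "(\<Union>j\<in>{0..n}. subcrystal n ({0..n} - {j}) (corner_monomial n \<l> j))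
      = {col c | c. column c \<and> (\<exists>j\<in>{0..n}. window (int j) c)}"
    using sub by auto
  moreover have "{col c | c. column c} =
    (\<Union>z::int. int_funpow (tau n \<l>) z ` {col c | c. column c \<and> (\<exists>j\<in>{0..n}. window (int j) c)})"
  proof (intro equalityI subsetI)
    fix m assume "m \<in> {col c | c. column c}"
    then obtain c where c: "m = col c" "column c" by auto
    define a z where "a = c 1 - 1" and "z = a div N"
    define d where "d = (\<lambda>k. c k + - (z * N))"
    have a: "a = int (nat (a mod N)) + z * N" unfolding nat_mod_N z_def by (rule mod_div_mult_eq[symmetric])
    have "window a c" using window_exists[OF c(2)] by (simp add: a_def)
    then have "window (int (nat (a mod N))) d"
      using a by (auto simp: window_def d_def)
    moreover have "column d" using c(2) unfolding d_def column_shift .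
    moreover have "m = int_funpow (tau n \<l>) z (col d)"
      by (simp add: int_funpow_tau_col c(1) d_def)
    ultimately show "m \<in> (\<Union>z::int. int_funpow (tau n \<l>) z `
        {col c | c. column c \<and> (\<exists>j\<in>{0..n}. window (int j) c)})"
      using nat_mod_N(2)[of a] by fastforce
  next
    fix m assume "m \<in> (\<Union>z::int. int_funpow (tau n \<l>) z `
        {col c | c. column c \<and> (\<exists>j\<in>{0..n}. window (int j) c)})"
    then show "m \<in> {col c | c. column c}"
      using column_shift by (auto simp: int_funpow_tau_col)
  qed
  ultimately show ?thesis by (simp add: base_eq_corner crystal_corner)
qed

end

theorem proposition3p19:
  fixes r n \<l> :: nat and s :: "nat \<Rightarrow> nat"
  assumes "r \<ge> 1" and "n = 2 * r + 1"
    and "1 \<le> \<l>" and "\<l> \<le> r + 1"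
    and "parity_function n s"
    and "base_monomial n \<l> \<in> monomial_group n s"
  shows "crystal n (base_monomial n \<l>) =
    (\<Union>k::int. int_funpow (tau n \<l>) k `
       (\<Union>j\<in>{0..n}. subcrystal n ({0..n} - {j}) (corner_monomial n \<l> j)))"
proof -
  interpret affine_columns n \<l>
    by unfold_locales (use assms in auto)
  show ?thesis by (rule crystal_eq_union_of_windows)
qed

end
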